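(* There exists a federated reinforcement learning instance consisting of two infinite-horizon discounted MDPs such that $$\max_{\pi\in\Pi_{\mathrm{det}}}J(\pi)<\max_{\pi\in\Pi_{\mathrm{sta}}}J(\pi)\qquad\text{and}\qquad\max_{\pi\in\Pi_{\mathrm{sta}}}J(\pi)<\max_{\pi\in\Pi_\ell}J(\pi).$$
   Context: A federated reinforcement learning (FRL) instance with $M$ agents consists of $M$ finite MDPs $\mathcal M_c=(\mathcal S,\mathcal A,\gamma,\mathsf P_c,\mathsf r_c,\rho)$, $c\in\{1,\dots,M\}$, sharing the finite state space $\mathcal S$, finite action space $\mathcal A$, discount factor $\gamma\in(0,1)$ and initial distribution $\rho$, but with possibly different transition kernels $\mathsf P_c$ and real-valued reward functions $\mathsf r_c:\mathcal S\times\mathcal A\to\mathbb{R}$. A single common policy $\pi$ is used by all agents, and the objective is $$J(\pi)=\frac1M\sum_{c=1}^M\mathbb{E}\Big[\sum_{t\ge0}\gamma^t\mathsf r_c(S_c^t,A_c^t)\Big],$$ where $S_c^0\sim\rho$, $A_c^t$ is drawn according to $\pi$, and $S_c^{t+1}\sim\mathsf P_c(\cdot|S_c^t,A_c^t)$. Policy classes: $\Pi_\ell$ is the set of history-dependent policies, i.e. sequences $(\pi^t)_{t\ge0}$ of decision rules mapping the local history $(S_c^0,A_c^0,\dots,S_c^t)$ observed by an agent $c$ up to time $t$ to a distribution over $\mathcal A$ (the same rules being applied by every agent to its own history); $\Pi_{\mathrm{sta}}$ is the set of stationary stochastic policies, i.e. maps $\mathcal S\to\mathcal P(\mathcal A)$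 (probability distributions on $\mathcal A$); $\Pi_{\mathrm{det}}$ is the set of deterministic stationary policies, i.e. maps $\mathcal S\to\mathcal A$. Thus $\Pi_{\mathrm{det}}\subset\Pi_{\mathrm{sta}}\subset\Pi_\ell$. *)

theory Defs
  imports "HOL-Probability.Probability"
begin

record ('s, 'a) frl =
  num_agents :: nat
  states :: "'s set"
  actions :: "'a set"
  discount :: real
  trans :: "nat \<Rightarrow> 's \<Rightarrow> 'a \<Rightarrow> 's pmf"
  reward :: "nat \<Rightarrow> 's \<Rightarrow> 'a \<Rightarrow> real"
  init :: "'s pmf"

text \<open>Agents are numbered from 1. The transition kernels and rewards are total functions on the
  ambient types; only their values on the finite carriers matter.\<close>

definition frl_instance :: "('s, 'a) frl \<Rightarrow> bool" where
  "frl_instance F \<longleftrightarrow>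
     1 \<le> num_agents F \<and>
     finite (states F) \<and> states F \<noteq> {} \<and>
     finite (actions F) \<and> actions F \<noteq> {} \<and>
     0 < discount F \<and> discount F < 1 \<and>
     set_pmf (init F) \<subseteq> states F \<and>
     (\<forall>c\<in>{1..num_agents F}. \<forall>s\<in>states F. \<forall>a\<in>actions F. set_pmf (trans F c s a) \<subseteq> states F)"

text \<open>A decision rule \<open>\<pi> t\<close> receives the local history up to time \<open>t\<close>, given as the list
  \<open>[(S_0, A_0), \<dots>, (S_(t-1), A_(t-1))]\<close> of length \<open>t\<close> together with the current state \<open>S_t\<close>.
  A policy has no agent index: every agent applies the same rules to its own history.\<close>

type_synonym ('s, 'a) policy = "nat \<Rightarrow> ('s \<times> 'a) list \<Rightarrow> 's \<Rightarrow> 'a pmf"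

definition history_policies :: "('s, 'a) frl \<Rightarrow> ('s, 'a) policy set" where
  "history_policies F =
     {\<pi>. \<forall>t h s. length h = t \<longrightarrow> set h \<subseteq> states F \<times> actions F \<longrightarrow> s \<in> states F \<longrightarrow>
            set_pmf (\<pi> t h s) \<subseteq> actions F}"

definition stationary_policies :: "('s, 'a) frl \<Rightarrow> ('s, 'a) policy set" where
  "stationary_policies F =
     {(\<lambda>t h s. \<mu> s) | \<mu>. \<forall>s\<in>states F. set_pmf (\<mu> s) \<subseteq> actions F}"

definition deterministic_policies :: "('s, 'a) frl \<Rightarrow> ('s, 'a) policy set" where
  "deterministic_policies F =
     {(\<lambda>t h s. return_pmf (f s)) | f. f \<in> states F \<rightarrow> actions F}"

lemma deterministic_subset_stationary: "deterministic_policies F \<subseteq> stationary_policies F"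
proof
  fix \<pi> assume "\<pi> \<in> deterministic_policies F"
  then obtain f where f: "f \<in> states F \<rightarrow> actions F" and \<pi>: "\<pi> = (\<lambda>t h s. return_pmf (f s))"
    by (auto simp: deterministic_policies_def)
  show "\<pi> \<in> stationary_policies F"
    unfolding stationary_policies_def \<pi>
    using f by (auto intro!: exI[of _ "\<lambda>s. return_pmf (f s)"])
qed

lemma stationary_subset_history: "stationary_policies F \<subseteq> history_policies F"
  by (auto simp: stationary_policies_def history_policies_def)

text \<open>Law of \<open>(S_t, A_t)\<close> for agent \<open>c\<close> given the past; \<open>\<omega> i\<close> is the pair \<open>(S_i, A_i)\<close>,
  and only the values \<open>\<omega> i\<close> with \<open>i < t\<close> are used.\<close>

definition step_law ::
  "('s, 'a) frl \<Rightarrow> nat \<Rightarrow> ('s, 'a) policy \<Rightarrow> nat \<Rightarrow> (nat \<Rightarrow> 's \<times> 'a) \<Rightarrow> ('s \<times> 'a) pmf" where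
  "step_law F c \<pi> t \<omega> =
     bind_pmf (case t of 0 \<Rightarrow> init F | Suc n \<Rightarrow> trans F c (fst (\<omega> n)) (snd (\<omega> n)))
       (\<lambda>s. map_pmf (\<lambda>a. (s, a)) (\<pi> t (map \<omega> [0..<t]) s))"

text \<open>The law of the whole trajectory of agent \<open>c\<close>, obtained from the step laws by the
  Ionescu-Tulcea theorem. The types are taken countable so that the product
  sigma-algebra over finitely many time points is discrete.\<close>

definition trajectory_measure ::
  "('s::countable, 'a::countable) frl \<Rightarrow> nat \<Rightarrow> ('s, 'a) policy \<Rightarrow> (nat \<Rightarrow> 's \<times> 'a) measure" where
  "trajectory_measure F c \<pi> =
     projective_family.lim UNIV
       (Ionescu_Tulcea.CI (\<lambda>t \<omega>. measure_pmf (step_law F c \<pi> t \<omega>)) (\<lambda>_. count_space UNIV))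
       (\<lambda>_. count_space UNIV)"

lemma Ionescu_Tulcea_step_law:
  fixes F :: "('s::countable, 'a::countable) frl"
  shows "Ionescu_Tulcea (\<lambda>t \<omega>. measure_pmf (step_law F c \<pi> t \<omega>)) (\<lambda>_. count_space UNIV)"
proof
  fix i :: nat
  have "countable (PiE {0..<i} (\<lambda>_. UNIV :: ('s \<times> 'a) set))"
    by (intro countable_PiE) auto
  then have "PiM {0..<i} (\<lambda>_. count_space (UNIV :: ('s \<times> 'a) set)) =
      count_space (PiE {0..<i} (\<lambda>_. UNIV))"
    by (intro count_space_PiM_finite) auto
  then show "(\<lambda>\<omega>. measure_pmf (step_law F c \<pi> i \<omega>)) \<in>
      measurable (PiM {0..<i} (\<lambda>_. count_space UNIV)) (subprob_algebra (count_space UNIV))"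
    by (simp add: measure_pmf_in_subprob_algebra)
qed

lemma prob_space_trajectory_measure: "prob_space (trajectory_measure F c \<pi>)"
proof -
  interpret Ionescu_Tulcea "\<lambda>t \<omega>. measure_pmf (step_law F c \<pi> t \<omega>)" "\<lambda>_. count_space UNIV"
    by (rule Ionescu_Tulcea_step_law)
  have "emeasure PF.lim (PF.emb UNIV {} {\<lambda>_. undefined}) = emeasure (CI {}) {\<lambda>_. undefined}"
    by (rule lim) (auto simp: PiM_empty)
  moreover have "PF.emb UNIV {} {\<lambda>_. undefined} = space PF.lim"
    by (auto simp: prod_emb_def space_PiM)
  moreover have "emeasure (CI {}) {\<lambda>_. undefined} = 1"
    using prob_space.emeasure_space_1[OF PF.prob_space_P[of "{}"]] by (simp add: CI_def space_PiM)
  ultimately show ?thesis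
    unfolding trajectory_measure_def by (intro prob_spaceI) simp
qed

definition J :: "('s::countable, 'a::countable) frl \<Rightarrow> ('s, 'a) policy \<Rightarrow> real" where
  "J F \<pi> =
     (\<Sum>c = 1..num_agents F.
        \<integral>\<omega>. (\<Sum>t. discount F ^ t * reward F c (fst (\<omega> t)) (snd (\<omega> t)))
          \<partial>trajectory_measure F c \<pi>) / real (num_agents F)"

end

theory Submission
  imports Defs
begin

text \<open>
  In state 0 agent \<open>c\<close> earns reward 1 and leaves for the absorbing, rewardless state 1 exactly when it
  plays action \<open>c\<close>; any other action keeps it in state 0. Both agents share the policy, so a
  deterministic stationary one serves a single agent forever. A stationary policy with
  \<open>p c\<close> the probability of action \<open>c\<close> in state 0 gives agent \<open>c\<close> the value \<open>2 * p c / (1 + p c)\<close>,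
  which is concave, hence uniform randomisation is best. Any policy satisfies
  \<open>p 1 + p 2 \<le> 1\<close> at time 0, and an agent not served at time 0 earns at most the discount factor;
  playing action 1 first and action 2 afterwards attains the resulting bound.
\<close>

section \<open>Finite-time marginals of the Ionescu-Tulcea limit measure\<close>

lemma (in Ionescu_Tulcea) CI_atLeastLessThan: "CI {0..<n} = C 0 n (\<lambda>_. undefined)"
proof -
  have "up_to {0..<n} = n"
    using up_to[of "{0..<n}"] by (intro antisym) (auto simp: up_to_iff)
  \<comment> \<open>\<open>CI\<close> restricts the law of the first \<open>up_to\<close>
    coordinates to the index set; on an initial segment that restriction changes nothing.\<close>
  then show ?thesis
    using distr_C[of n n "\<lambda>_. undefined" 0] by (simp add: CI_def space_PiM)
qed

lemma (in Ionescu_Tulcea) nn_integral_lim_restrict: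
  assumes f[measurable]: "f \<in> borel_measurable (PiM {0..<n} M)"
  shows "(\<integral>\<^sup>+\<omega>. f (restrict \<omega> {0..<n}) \<partial>PF.lim) = (\<integral>\<^sup>+\<omega>. f \<omega> \<partial>C 0 n (\<lambda>_. undefined))"
proof -
  have "(\<lambda>\<omega>. restrict \<omega> {0..<n}) \<in> measurable PF.lim (PiM {0..<n} M)"
    by (subst measurable_cong_sets[OF PF.sets_lim refl]) (auto intro!: measurable_restrict_subset)
  then have "(\<integral>\<^sup>+\<omega>. f (restrict \<omega> {0..<n}) \<partial>PF.lim)
      = (\<integral>\<^sup>+\<omega>. f \<omega> \<partial>distr PF.lim (PiM {0..<n} M) (\<lambda>\<omega>. restrict \<omega> {0..<n}))"
    by (simp add: nn_integral_distr)
  then show ?thesis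
    by (simp add: distr_lim CI_atLeastLessThan)
qed

text \<open>The tower property: conditioning on the first \<open>n\<close> coordinates leaves
  coordinate \<open>n\<close> distributed by \<open>P n\<close>. It follows by passing to
  \<open>C\<close>, unfolding its last kernel step \<open>eP n\<close>, and passing back to the
  limit.\<close>

lemma (in Ionescu_Tulcea) nn_integral_lim_Suc:
  assumes f[measurable]: "f \<in> borel_measurable (PiM {0..<Suc n} M)"
  shows "(\<integral>\<^sup>+\<omega>. f (restrict \<omega> {0..<Suc n}) \<partial>PF.lim) =
    (\<integral>\<^sup>+\<omega>. \<integral>\<^sup>+x. f ((restrict \<omega> {0..<n})(n := x)) \<partial>P n (restrict \<omega> {0..<n}) \<partial>PF.lim)"
proof -
  let ?C = "\<lambda>n. C 0 n (\<lambda>_. undefined)"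
  have undef: "(\<lambda>_. undefined) \<in> space (PiM {0..<0} M)"
    by (simp add: space_PiM)
  note sC = sets_C[OF undef, simplified] space_C[OF undef, simplified]
  have eP: "eP n \<in> measurable (?C n) (subprob_algebra (PiM {0..<Suc n} M))"
    by (subst measurable_cong_sets[OF sC(1) refl]) (rule measurable_eP)
  \<comment> \<open>Measurability in the past is clear for integrals against the kernel
    \<open>eP n\<close>; the form with \<open>P n\<close> agrees with it on the space and inherits
    it.\<close>
  have "(\<lambda>\<omega>. \<integral>\<^sup>+x. f x \<partial>eP n \<omega>) \<in> borel_measurable (PiM {0..<n} M)"
    by measurable
  then have m: "(\<lambda>\<omega>. \<integral>\<^sup>+x. f (fun_upd \<omega> n x) \<partial>P n \<omega>) \<in> borel_measurable (PiM {0..<n} M)"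
    by (subst (asm) measurable_cong[OF nn_integral_eP[OF _ f]])
  have "(\<integral>\<^sup>+\<omega>. f (restrict \<omega> {0..<Suc n}) \<partial>PF.lim) = (\<integral>\<^sup>+\<omega>. f \<omega> \<partial>(?C n \<bind> eP n))"
    by (simp add: nn_integral_lim_restrict[OF f])
  also have "\<dots> = (\<integral>\<^sup>+\<omega>. \<integral>\<^sup>+x. f x \<partial>eP n \<omega> \<partial>?C n)"
    by (rule nn_integral_bind[OF f eP])
  also have "\<dots> = (\<integral>\<^sup>+\<omega>. \<integral>\<^sup>+x. f (fun_upd \<omega> n x) \<partial>P n \<omega> \<partial>?C n)"
    by (intro nn_integral_cong nn_integral_eP f) (simp add: sC)
  also have "\<dots> = (\<integral>\<^sup>+\<omega>. \<integral>\<^sup>+x. f ((restrict \<omega> {0..<n})(n := x)) \<partial>P n (restrict \<omega> {0..<n}) \<partial>PF.lim)"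
    by (rule nn_integral_lim_restrict[OF m, symmetric])
  finally show ?thesis .
qed

section \<open>One-step laws under the trajectory measure\<close>

lemma sets_trajectory_measure [measurable_cong]:
  "sets (trajectory_measure F c \<pi>) = sets (PiM UNIV (\<lambda>_. count_space UNIV))"
proof -
  interpret Ionescu_Tulcea "\<lambda>t \<omega>. measure_pmf (step_law F c \<pi> t \<omega>)" "\<lambda>_. count_space UNIV"
    by (rule Ionescu_Tulcea_step_law)
  show ?thesis
    by (simp add: trajectory_measure_def)
qed

lemma space_trajectory_measure [simp]: "space (trajectory_measure F c \<pi>) = UNIV"
  using sets_eq_imp_space_eq[OF sets_trajectory_measure, of F c \<pi>] by (simp add: space_PiM)

lemma measurable_trajectory_component:
  "(\<lambda>\<omega>. \<omega> n) \<in> measurable (trajectory_measure F c \<pi>) (count_space UNIV)"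
  by (subst measurable_cong_sets[OF sets_trajectory_measure refl]) (rule measurable_component_singleton, simp)

lemma sets_trajectory_component: "{\<omega>. \<omega> n \<in> X} \<in> sets (trajectory_measure F c \<pi>)"
  using measurable_sets[OF measurable_trajectory_component, of X n F c \<pi>] by (simp add: vimage_def)

text \<open>This is \<open>nn_integral_lim_Suc\<close> for the indicator of an event in coordinate
  \<open>n\<close>. All later probabilities come from it, without further use of the construction of
  the measure.\<close>

lemma emeasure_trajectory_step:
  "emeasure (trajectory_measure F c \<pi>) {\<omega>. \<omega> n \<in> X} =
    (\<integral>\<^sup>+\<omega>. emeasure (step_law F c \<pi> n \<omega>) X \<partial>trajectory_measure F c \<pi>)"
proof -
  interpret Ionescu_Tulcea "\<lambda>t \<omega>. measure_pmf (step_law F c \<pi> t \<omega>)" "\<lambda>_. count_space UNIV"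
    by (rule Ionescu_Tulcea_step_law)
  have "(\<integral>\<^sup>+\<omega>. indicator X (restrict \<omega> {0..<Suc n} n) \<partial>trajectory_measure F c \<pi>) =
     (\<integral>\<^sup>+\<omega>. \<integral>\<^sup>+x. indicator X (((restrict \<omega> {0..<n})(n := x)) n)
        \<partial>step_law F c \<pi> n (restrict \<omega> {0..<n}) \<partial>trajectory_measure F c \<pi>)"
    unfolding trajectory_measure_def
    by (rule nn_integral_lim_Suc[of "\<lambda>\<omega>. indicator X (\<omega> n)"]) measurable
  \<comment> \<open>\<open>step_law\<close> at time \<open>n\<close> reads only coordinates below
    \<open>n\<close>, so truncating the trajectory there is harmless.\<close>
  moreover have "step_law F c \<pi> n (restrict \<omega> {0..<n}) = step_law F c \<pi> n \<omega>" for \<omega>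
    by (auto simp: step_law_def split: nat.split intro!: arg_cong2[where f = bind_pmf] ext 
        arg_cong[where f = "map_pmf _"] arg_cong[where f = "\<lambda>h. \<pi> _ h _"])
  moreover have "indicator X (\<omega> n) = (indicator {\<omega>. \<omega> n \<in> X} \<omega> :: ennreal)" for \<omega> :: "nat \<Rightarrow> _"
    by (simp add: indicator_def)
  ultimately show ?thesis
    by (simp add: sets_trajectory_component)
qed

definition state_law :: "('s, 'a) frl \<Rightarrow> nat \<Rightarrow> nat \<Rightarrow> (nat \<Rightarrow> 's \<times> 'a) \<Rightarrow> 's pmf" where
  "state_law F c t \<omega> = (case t of 0 \<Rightarrow> init F | Suc n \<Rightarrow> trans F c (fst (\<omega> n)) (snd (\<omega> n)))"

lemma map_fst_step_law: "map_pmf fst (step_law F c \<pi> t \<omega>) = state_law F c t \<omega>"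
  by (simp add: step_law_def state_law_def map_bind_pmf pmf.map_comp o_def bind_return_pmf')

lemma pmf_step_law:
  "pmf (step_law F c \<pi> t \<omega>) (s, a) = pmf (state_law F c t \<omega>) s * pmf (\<pi> t (map \<omega> [0..<t]) s) a"
proof -
  have "pmf (map_pmf (Pair s') (\<pi> t (map \<omega> [0..<t]) s')) (s, a)
      = pmf (\<pi> t (map \<omega> [0..<t]) s) a * indicator {s} s'" for s'
    by (cases "s' = s") (auto simp: pmf_map_inj' inj_on_def pmf_eq_0_set_pmf)
  then show ?thesis
    by (simp add: step_law_def state_law_def[symmetric] pmf_bind measure_pmf_single)
qed

lemma emeasure_trajectory_state:
  "emeasure (trajectory_measure F c \<pi>) {\<omega>. fst (\<omega> t) = s} =
    (\<integral>\<^sup>+\<omega>. pmf (state_law F c t \<omega>) s \<partial>trajectory_measure F c \<pi>)"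
proof -
  have "emeasure (step_law F c \<pi> t \<omega>) {x. fst x = s} = pmf (state_law F c t \<omega>) s" for \<omega>
  proof -
    have "emeasure (step_law F c \<pi> t \<omega>) {x. fst x = s}
        = emeasure (map_pmf fst (step_law F c \<pi> t \<omega>)) {s}"
      by (simp add: vimage_def)
    then show ?thesis
      by (simp add: map_fst_step_law emeasure_pmf_single)
  qed
  then show ?thesis
    using emeasure_trajectory_step[of F c \<pi> t "{x. fst x = s}"] by simp
qed

lemma measurable_pmf_state_law:
  "(\<lambda>\<omega>. ennreal (pmf (state_law F c t \<omega>) s)) \<in> borel_measurable (trajectory_measure F c \<pi>)"
proof (cases t)
  case (Suc n)
  from measurable_compose[OF measurable_trajectory_component, of "\<lambda>x. ennreal (pmf (trans F c (fst x) (snd x)) s)" borel]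
  show ?thesis
    by (simp add: state_law_def Suc)
qed (simp add: state_law_def)

text \<open>When the rule at time \<open>t\<close> in state \<open>s\<close> ignores the history,
  the action probability is constant and leaves the integral over the past.\<close>

lemma measure_trajectory_state_action:
  assumes "\<And>h. length h = t \<Longrightarrow> \<pi> t h s = q"
  shows "measure (trajectory_measure F c \<pi>) {\<omega>. \<omega> t = (s, a)} =
    measure (trajectory_measure F c \<pi>) {\<omega>. fst (\<omega> t) = s} * pmf q a"
proof -
  have "emeasure (trajectory_measure F c \<pi>) {\<omega>. \<omega> t = (s, a)} =
      (\<integral>\<^sup>+\<omega>. ennreal (pmf (state_law F c t \<omega>) s) * ennreal (pmf q a) \<partial>trajectory_measure F c \<pi>)"
    using emeasure_trajectory_step[of F c \<pi> t "{(s, a)}"]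
    by (simp add: emeasure_pmf_single pmf_step_law assms ennreal_mult)
  also have "\<dots> = emeasure (trajectory_measure F c \<pi>) {\<omega>. fst (\<omega> t) = s} * ennreal (pmf q a)"
    by (simp add: nn_integral_multc measurable_pmf_state_law emeasure_trajectory_state)
  finally show ?thesis
    by (simp add: measure_def enn2real_mult)
qed

section \<open>Interchange of expectation and discounted sum\<close>

lemma integral_discounted_reward:
  fixes F :: "('s::countable, 'a::countable) frl" and r :: "'s \<times> 'a \<Rightarrow> real"
  assumes r: "\<And>x. \<bar>r x\<bar> \<le> B" and g: "0 \<le> g" "g < 1"
  shows "((\<lambda>t. g ^ t * (\<integral>\<omega>. r (\<omega> t) \<partial>trajectory_measure F c \<pi>)) sums
    (\<integral>\<omega>. (\<Sum>t. g ^ t * r (\<omega> t)) \<partial>trajectory_measure F c \<pi>))"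
proof -
  interpret prob_space "trajectory_measure F c \<pi>"
    by (rule prob_space_trajectory_measure)
  have meas: "(\<lambda>\<omega>. r (\<omega> t)) \<in> borel_measurable (trajectory_measure F c \<pi>)" for t
    using measurable_compose[OF measurable_trajectory_component, of r borel] by simp
  have int: "integrable (trajectory_measure F c \<pi>) (\<lambda>\<omega>. r (\<omega> t))" for t
    using r meas by (intro integrable_const_bound[where B = B]) auto
  \<comment> \<open>The geometric series of \<open>g ^ t * B\<close> dominates both pathwise and in
    expectation, which gives both summability conditions of \<open>sums_integral\<close>.\<close>
  have geo: "summable (\<lambda>t. g ^ t * B)"
    using g by (intro summable_mult2 summable_geometric) simp
  have le: "norm (g ^ t * r x) \<le> g ^ t * B" for t x
    using g r by (simp add: abs_mult mult_left_mono)
  have "(\<lambda>t. \<integral>\<omega>. g ^ t * r (\<omega> t) \<partial>trajectory_measure F c \<pi>) sums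
      (\<integral>\<omega>. (\<Sum>t. g ^ t * r (\<omega> t)) \<partial>trajectory_measure F c \<pi>)"
  proof (rule sums_integral)
    show "AE \<omega> in trajectory_measure F c \<pi>. summable (\<lambda>t. norm (g ^ t * r (\<omega> t)))"
      using le by (intro AE_I2 summable_comparison_test'[OF geo, of 0]) simp
    have "norm (\<integral>\<omega>. norm (g ^ t * r (\<omega> t)) \<partial>trajectory_measure F c \<pi>) \<le> g ^ t * B" for t
    proof -
      have "(\<integral>\<omega>. norm (g ^ t * r (\<omega> t)) \<partial>trajectory_measure F c \<pi>) \<le>
          (\<integral>\<omega>. g ^ t * B \<partial>trajectory_measure F c \<pi>)"
        using int le by (intro integral_mono) auto
      then show ?thesis
        using prob_space by simp
    qed
    then show "summable (\<lambda>t. \<integral>\<omega>. norm (g ^ t * r (\<omega> t)) \<partial>trajectory_measure F c \<pi>)"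
      by (intro summable_comparison_test'[OF geo, of 0]) auto
  qed (use int in auto)
  then show ?thesis
    by simp
qed

section \<open>The two-agent instance and its survival probabilities\<close>

definition lock :: "(nat, nat) frl" where
  "lock = \<lparr>num_agents = 2, states = {0, 1}, actions = {1, 2}, discount = 1 / 2,
     trans = (\<lambda>c s a. return_pmf (if s = 0 \<and> a \<noteq> c then 0 else 1)),
     reward = (\<lambda>c s a. of_bool (s = 0 \<and> a = c)), init = return_pmf 0\<rparr>"

lemma frl_instance_lock: "frl_instance lock"
  by (simp add: frl_instance_def lock_def)

definition alive :: "nat \<Rightarrow> (nat, nat) policy \<Rightarrow> nat \<Rightarrow> real" where
  "alive c \<pi> t = measure (trajectory_measure lock c \<pi>) {\<omega>. fst (\<omega> t) = 0}"

text \<open>Equally the expected reward of agent \<open>c\<close> at time \<open>t\<close>, because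
  the reward is the indicator of this event.\<close>

definition hit :: "nat \<Rightarrow> (nat, nat) policy \<Rightarrow> nat \<Rightarrow> real" where
  "hit c \<pi> t = measure (trajectory_measure lock c \<pi>) {\<omega>. \<omega> t = (0, c)}"

lemma alive_nonneg: "0 \<le> alive c \<pi> t" and hit_nonneg: "0 \<le> hit c \<pi> t"
  by (simp_all add: alive_def hit_def)

lemma alive_0: "alive c \<pi> 0 = 1"
proof -
  interpret prob_space "trajectory_measure lock c \<pi>"
    by (rule prob_space_trajectory_measure)
  show ?thesis
    using emeasure_trajectory_state[of lock c \<pi> 0 0] emeasure_space_1
    by (simp add: alive_def measure_def state_law_def lock_def)
qed

text \<open>State 1 is absorbing and state 0 is left only by a hit, so survival to
  \<open>Suc t\<close> means survival to \<open>t\<close> without a hit at \<open>t\<close>.\<close>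

lemma alive_Suc: "alive c \<pi> (Suc t) = alive c \<pi> t - hit c \<pi> t"
proof -
  let ?T = "trajectory_measure lock c \<pi>"
  interpret prob_space ?T
    by (rule prob_space_trajectory_measure)
  have state: "{\<omega>. fst (\<omega> t) = 0} \<in> sets ?T" and act: "{\<omega>. \<omega> t = (0, c)} \<in> sets ?T"
    using sets_trajectory_component[of t "{x. fst x = 0}"] sets_trajectory_component[of t "{(0, c)}"]
    by simp_all
  have "ennreal (pmf (state_law lock c (Suc t) \<omega>) 0)
      = indicator ({\<omega>. fst (\<omega> t) = 0} - {\<omega>. \<omega> t = (0, c)}) \<omega>" for \<omega>
    by (cases "\<omega> t") (auto simp: state_law_def lock_def indicator_def)
  then have "emeasure ?T {\<omega>. fst (\<omega> (Suc t)) = 0}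
      = emeasure ?T ({\<omega>. fst (\<omega> t) = 0} - {\<omega>. \<omega> t = (0, c)})"
    using state act by (simp add: emeasure_trajectory_state)
  then have "alive c \<pi> (Suc t) = prob ({\<omega>. fst (\<omega> t) = 0} - {\<omega>. \<omega> t = (0, c)})"
    by (simp add: alive_def measure_def)
  also have "\<dots> = alive c \<pi> t - hit c \<pi> t"
    unfolding alive_def hit_def using state act by (intro finite_measure_Diff) auto
  finally show ?thesis .
qed

lemma hit_eq:
  assumes "\<And>h. length h = t \<Longrightarrow> \<pi> t h 0 = q"
  shows "hit c \<pi> t = alive c \<pi> t * pmf q c"
  unfolding hit_def alive_def by (rule measure_trajectory_state_action) (rule assms)

text \<open>The empty list is the only history of length 0, so \<open>hit_eq\<close> applies at time
  0 to every policy.\<close>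

lemma hit_0: "hit c \<pi> 0 = pmf (\<pi> 0 [] 0) c"
  by (subst hit_eq[of 0 \<pi> "\<pi> 0 [] 0"]) (simp_all add: alive_0)

section \<open>Discounted values of the two agents\<close>

definition agent_value :: "nat \<Rightarrow> (nat, nat) policy \<Rightarrow> real" where
  "agent_value c \<pi> = (\<Sum>t. (1 / 2) ^ t * hit c \<pi> t)"

lemma hit_sums:
  "(\<lambda>t. (1 / 2) ^ t * hit c \<pi> t) sums
    (\<integral>\<omega>. (\<Sum>t. (1 / 2) ^ t * reward lock c (fst (\<omega> t)) (snd (\<omega> t))) \<partial>trajectory_measure lock c \<pi>)"
proof -
  have "hit c \<pi> t = (\<integral>\<omega>. reward lock c (fst (\<omega> t)) (snd (\<omega> t)) \<partial>trajectory_measure lock c \<pi>)" for t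
  proof -
    have "reward lock c (fst (\<omega> t)) (snd (\<omega> t)) = indicator {\<omega>. \<omega> t = (0, c)} \<omega>" for \<omega>
      by (cases "\<omega> t") (simp add: lock_def indicator_def)
    then show ?thesis
      by (simp add: hit_def)
  qed
  then show ?thesis
    using integral_discounted_reward[of "\<lambda>x. reward lock c (fst x) (snd x)" 1 "1 / 2" lock c \<pi>]
    by (simp add: lock_def)
qed

lemma J_lock: "J lock \<pi> = (agent_value 1 \<pi> + agent_value 2 \<pi>) / 2"
  using hit_sums[of _ \<pi>, THEN sums_unique]
  by (simp add: J_def agent_value_def lock_def numeral_2_eq_2)

text \<open>After time 0 the discount is at most 1/2 and the hit probabilities telescope to at most
  \<open>alive c \<pi> 1 = 1 - hit c \<pi> 0\<close>. Hence the value is at most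
  \<open>hit c \<pi> 0 + (1 - hit c \<pi> 0) / 2\<close>.\<close>

lemma agent_value_le: "agent_value c \<pi> \<le> (1 + hit c \<pi> 0) / 2"
proof -
  \<comment> \<open>The range \<open>Suc n\<close> keeps the undiscounted term at time 0 apart from
    the telescoping sum.\<close>
  have partial: "(\<Sum>t<Suc n. (1 / 2) ^ t * hit c \<pi> t) \<le> hit c \<pi> 0 + (alive c \<pi> 1 - alive c \<pi> (Suc n)) / 2" for n
  proof (induction n)
    case (Suc n)
    have "(1 / 2) ^ Suc n * hit c \<pi> (Suc n) \<le> 1 / 2 * hit c \<pi> (Suc n)"
      using power_le_one[of "1 / 2 :: real" n] hit_nonneg by (intro mult_right_mono) auto
    with Suc show ?case
      by (simp add: alive_Suc field_simps)
  qed simp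
  have "(\<Sum>t<n. (1 / 2) ^ t * hit c \<pi> t) \<le> (1 + hit c \<pi> 0) / 2" for n
  proof -
    have "(\<Sum>t<n. (1 / 2) ^ t * hit c \<pi> t) \<le> (\<Sum>t<Suc n. (1 / 2) ^ t * hit c \<pi> t)"
      by (simp add: hit_nonneg)
    then show ?thesis
      using partial[of n] alive_nonneg[of c \<pi> "Suc n"] alive_Suc[of c \<pi> 0]
      unfolding alive_0 One_nat_def by argo
  qed
  then show ?thesis
    unfolding agent_value_def using hit_sums[of c \<pi>] by (intro suminf_le_const) (auto simp: sums_iff)
qed

text \<open>One term suffices as a lower bound for a policy that makes each agent hit surely at a
  known time.\<close>

lemma agent_value_ge: "(1 / 2) ^ t * hit c \<pi> t \<le> agent_value c \<pi>"
  unfolding agent_value_def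
  using sum_le_suminf[of "\<lambda>t. (1 / 2) ^ t * hit c \<pi> t" "{t}"] hit_sums[of c \<pi>]
  by (simp add: sums_iff hit_nonneg)

text \<open>A constant hit probability p makes the hitting time geometric: survival is (1 - p)^t,
  and the value is p times a geometric series of ratio (1 - p)/2.\<close>

lemma agent_value_stationary:
  "agent_value c (\<lambda>t h s. \<mu> s) = 2 * pmf (\<mu> 0) c / (1 + pmf (\<mu> 0) c)"
proof -
  let ?\<pi> = "\<lambda>t h s. \<mu> s" and ?p = "pmf (\<mu> 0) c"
  have hit: "hit c ?\<pi> t = alive c ?\<pi> t * ?p" for t
    by (rule hit_eq) simp
  have "alive c ?\<pi> t = (1 - ?p) ^ t" for t
    by (induction t) (simp_all add: alive_0 alive_Suc hit algebra_simps)
  then have "(1 / 2) ^ t * hit c ?\<pi> t = ((1 - ?p) / 2) ^ t * ?p" for t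
    by (simp add: hit power_divide)
  moreover have "(\<lambda>t. ((1 - ?p) / 2) ^ t * ?p) sums (1 / (1 - (1 - ?p) / 2) * ?p)"
    using pmf_le_1[of "\<mu> 0" c] pmf_nonneg[of "\<mu> 0" c]
    by (intro sums_mult2 geometric_sums) (simp add: abs_if del: pmf_nonneg)
  ultimately have "agent_value c ?\<pi> = 1 / (1 - (1 - ?p) / 2) * ?p"
    by (simp add: agent_value_def sums_iff)
  also have "\<dots> = 2 * ?p / (1 + ?p)"
    using add_pos_nonneg[OF zero_less_one pmf_nonneg, of "\<mu> 0" c] by (simp add: field_simps)
  finally show ?thesis .
qed

section \<open>Bounds on the objective over the three policy classes\<close>

lemma pmf_add_le_1: "x \<noteq> y \<Longrightarrow> pmf p x + pmf p y \<le> 1"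
  using measure_pmf.prob_le_1[of p "{x, y}"] by (simp add: measure_measure_pmf_finite)

text \<open>Both agents draw their first action from the same distribution
  \<open>\<pi> 0 [] 0\<close>, so their time-0 hit probabilities sum to at most 1; averaging the two
  value bounds gives (2 + 1)/4.\<close>

lemma J_lock_le: "J lock \<pi> \<le> 3 / 4"
  using agent_value_le[of 1 \<pi>] agent_value_le[of 2 \<pi>] pmf_add_le_1[of 1 2 "\<pi> 0 [] 0"]
  by (simp add: J_lock hit_0)

lemma J_lock_stationary_le: "J lock (\<lambda>t h s. \<mu> s) \<le> 2 / 3"
proof -
  have "2 * pmf (\<mu> 0) c / (1 + pmf (\<mu> 0) c) \<le> 2 * (1 + 4 * pmf (\<mu> 0) c) / 9" for c
    \<comment> \<open>the tangent of the concave function \<open>2 * p / (1 + p)\<close> at \<open>p = 1 / 2\<close>\<close>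
  proof -
    \<comment> \<open>After clearing denominators, the gap between tangent and function is a
      positive multiple of this square.\<close>
    have "0 \<le> (2 * pmf (\<mu> 0) c - 1)\<^sup>2" "0 < 1 + pmf (\<mu> 0) c"
      by (simp_all add: add_pos_nonneg)
    then show ?thesis
      by (simp add: pos_divide_le_eq algebra_simps power2_eq_square)
  qed
  \<comment> \<open>The tangent bounds add up to an affine function of the total hit probability,
    which is at most 1; half of 2 * (2 + 4)/9 is 2/3.\<close>
  from this[of 1] this[of 2] show ?thesis
    using pmf_add_le_1[of 1 2 "\<mu> 0"] by (simp add: J_lock agent_value_stationary)
qed

text \<open>The agent whose action is chosen in state 0 has value 1 and the other has value 0,
  whichever action it is.\<close>

lemma J_lock_deterministic:
  assumes "\<pi> \<in> deterministic_policies lock"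
  shows "J lock \<pi> = 1 / 2"
proof -
  obtain f where f: "f 0 \<in> {1, 2}" and \<pi>: "\<pi> = (\<lambda>t h s. return_pmf (f s))"
    using assms by (auto simp: deterministic_policies_def lock_def Pi_iff)
  show ?thesis
    using f unfolding \<pi> J_lock agent_value_stationary by auto
qed

theorem theorem6p1:
  shows "\<exists>F :: (nat, nat) frl. frl_instance F \<and> num_agents F = 2 \<and>
    (\<exists>\<pi>_det \<pi>_sta \<pi>_hist.
       is_arg_max (J F) (\<lambda>\<pi>. \<pi> \<in> deterministic_policies F) \<pi>_det \<and>
       is_arg_max (J F) (\<lambda>\<pi>. \<pi> \<in> stationary_policies F) \<pi>_sta \<and>
       is_arg_max (J F) (\<lambda>\<pi>. \<pi> \<in> history_policies F) \<pi>_hist \<and>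
       J F \<pi>_det < J F \<pi>_sta \<and> J F \<pi>_sta < J F \<pi>_hist)"
proof -
  define \<pi>_det :: "(nat, nat) policy" where "\<pi>_det = (\<lambda>t h s. return_pmf 1)"
  define \<pi>_sta :: "(nat, nat) policy" where "\<pi>_sta = (\<lambda>t h s. pmf_of_set {1, 2})"
  define \<pi>_hist :: "(nat, nat) policy" where "\<pi>_hist = (\<lambda>t h s. return_pmf (if t = 0 then 1 else 2))"
  have det: "\<pi>_det \<in> deterministic_policies lock"
    by (auto simp: \<pi>_det_def deterministic_policies_def lock_def intro!: exI[of _ "\<lambda>_. 1"])
  have sta: "\<pi>_sta \<in> stationary_policies lock"
    by (auto simp: \<pi>_sta_def stationary_policies_def lock_def intro!: exI[of _ "\<lambda>_. pmf_of_set {1, 2}"])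
  have hist: "\<pi>_hist \<in> history_policies lock"
    by (simp add: \<pi>_hist_def history_policies_def lock_def)
  have J_sta: "J lock \<pi>_sta = 2 / 3"
    unfolding \<pi>_sta_def J_lock agent_value_stationary by simp
  \<comment> \<open>Action 1 leaves agent 2 in state 0, so it is surely alive at time 1 and then
    hits with probability 1.\<close>
  have "hit 2 \<pi>_hist 1 = alive 2 \<pi>_hist 1 * pmf (return_pmf (2 :: nat)) 2"
    by (rule hit_eq) (simp add: \<pi>_hist_def)
  then have "hit 1 \<pi>_hist 0 = 1" "hit 2 \<pi>_hist 1 = 1"
    using alive_Suc[of 2 \<pi>_hist 0] by (simp_all add: hit_0 alive_0 \<pi>_hist_def)
  \<comment> \<open>The sure hits contribute 1 for agent 1 and the discounted 1/2 for agent 2; their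
    average 3/4 meets the upper bound.\<close>
  then have J_hist: "J lock \<pi>_hist = 3 / 4"
    using agent_value_ge[of 0 1 \<pi>_hist] agent_value_ge[of 1 2 \<pi>_hist] J_lock_le[of \<pi>_hist]
    by (simp add: J_lock)
  \<comment> \<open>The objective is constant on this class, so any member is a maximiser.\<close>
  have "is_arg_max (J lock) (\<lambda>\<pi>. \<pi> \<in> deterministic_policies lock) \<pi>_det"
    using det by (auto simp: is_arg_max_def J_lock_deterministic)
  moreover have "is_arg_max (J lock) (\<lambda>\<pi>. \<pi> \<in> stationary_policies lock) \<pi>_sta"
    using sta J_lock_stationary_le by (auto simp: is_arg_max_def J_sta stationary_policies_def not_less)
  moreover have "is_arg_max (J lock) (\<lambda>\<pi>. \<pi> \<in> history_policies lock) \<pi>_hist"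
    using hist J_lock_le by (auto simp: is_arg_max_def J_hist not_less)
  moreover have "J lock \<pi>_det < J lock \<pi>_sta" "J lock \<pi>_sta < J lock \<pi>_hist"
    using det by (simp_all add: J_sta J_hist J_lock_deterministic)
  moreover have "num_agents lock = 2"
    by (simp add: lock_def)
  ultimately show ?thesis
    using frl_instance_lock by blast
qed

end
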